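(* Let $B_n$ denote the $n$-th Bell number, i.e. the number of partitions of the set $\{1,2,\ldots,n\}$. The sequence $\{\sqrt[n]{B_n}\}_{n\geq 1}$ is strictly increasing; that is, $\sqrt[n]{B_n}<\sqrt[n+1]{B_{n+1}}$ for all integers $n\geq 1$. *)

theory Defs
  imports Complex_Main "HOL-Library.Disjoint_Sets"
begin

definition Bell :: "nat \<Rightarrow> nat" where
  "Bell n = card {P. partition_on {1..n} P}"

end

theory Submission
  imports Defs
begin

text \<open>
  The idea is that Bell numbers are moments of a positive measure, and moment sequences are
  log-convex.  Dobinski's formula \<open>e * B\<^sub>n = (\<Sum>k. k ^ n / k!)\<close> exhibits the measure: mass
  \<open>1 / (e * k!)\<close> at each natural number \<open>k\<close>, the Poisson distribution with mean \<open>1\<close>.  For every real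
  \<open>t\<close> the moment of the nonnegative function \<open>k ^ n * (k - t)\<^sup>2\<close> is nonnegative; for the best \<open>t\<close>
  this says \<open>B\<^sub>n\<^sub>+\<^sub>1\<^sup>2 \<le> B\<^sub>n * B\<^sub>n\<^sub>+\<^sub>2\<close> (\<open>dobinski_log_convex\<close>).

  Log-convexity says that the ratios of consecutive terms increase, and as \<open>B\<^sub>0 = 1\<close>, the
  root of index \<open>n\<close> of \<open>B\<^sub>n\<close> is the geometric mean of the first \<open>n\<close> ratios.  Means of an increasing
  sequence increase, and strictly so here because the first two ratios, \<open>1\<close> and \<open>2\<close>, differ
  (\<open>log_convex_power_less\<close>).

  Dobinski's formula follows because both sides satisfy the same recurrence.  For
  partitions, remove the block that contains a chosen element (\<open>card_partitions_insert\<close>); for the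
  series, shift the summation index and expand \<open>(k + 1) ^ n\<close> (\<open>dobinski_recurrence\<close>).
\<close>

section \<open>The recurrence for the number of partitions\<close>

text \<open>
  A partition of \<open>insert a A\<close> is determined by the set \<open>B\<close> of elements of \<open>A\<close> outside the block of
  \<open>a\<close>, together with the partition of \<open>B\<close> formed by the other blocks.
\<close>

lemma card_partitions_insert:
  assumes "finite A" and "a \<notin> A"
  shows "card {P. partition_on (insert a A) P} = (\<Sum>B\<in>Pow A. card {P. partition_on B P})"
proof -
  let ?S = "SIGMA B:Pow A. {P. partition_on B P}"
  let ?f = "\<lambda>(B, P). insert (insert a (A - B)) P"
  have no_a: "\<forall>p\<in>P. a \<notin> p" if "B \<subseteq> A" "partition_on B P" for B P
    using that assms(2) partition_onD1 by fastforce
  have "bij_betw ?f ?S {P. partition_on (insert a A) P}"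
    unfolding bij_betw_def
  proof
    show "inj_on ?f ?S"
    proof (rule inj_onI, clarify)
      fix B P C Q
      assume B: "B \<subseteq> A" "partition_on B P" and C: "C \<subseteq> A" "partition_on C Q"
        and eq: "insert (insert a (A - B)) P = insert (insert a (A - C)) Q"
      \<comment> \<open>The blocks that avoid \<open>a\<close> can be read off from the image.\<close>
      have "P = {p \<in> insert (insert a (A - B)) P. a \<notin> p}"
        using no_a[OF B] by auto
      also have "\<dots> = {p \<in> insert (insert a (A - C)) Q. a \<notin> p}"
        by (simp only: eq)
      also have "\<dots> = Q"
        using no_a[OF C] by auto
      finally have "P = Q" .
      then show "B = C \<and> P = Q"
        using partition_onD1[OF B(2)] partition_onD1[OF C(2)] by simp
    qed
  next
    show "?f ` ?S = {P. partition_on (insert a A) P}"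
    proof (intro equalityI subsetI)
      fix R
      assume "R \<in> ?f ` ?S"
      then obtain B P where B: "B \<subseteq> A" "partition_on B P"
        and R: "R = insert (insert a (A - B)) P"
        by auto
      have "\<Union>P = B"
        using partition_onD1[OF B(2)] by simp
      then have "disjnt (insert a (A - B)) (\<Union>P)"
        using B(1) assms(2) by (auto simp: disjnt_iff)
      moreover have "insert a A - insert a (A - B) = B"
        using B(1) assms(2) by auto
      ultimately show "R \<in> {P. partition_on (insert a A) P}"
        using B(2) R by (auto simp: partition_on_insert)
    next
      fix R
      assume "R \<in> {P. partition_on (insert a A) P}"
      then have R: "partition_on (insert a A) R"
        by simp
      then obtain p where p: "p \<in> R" "a \<in> p"
        using partition_onD1 by blast
      define B where "B = insert a A - p"
      have R_split: "R = insert p (R - {p})"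
        using p(1) by blast
      have "disjnt p (\<Union>(R - {p}))"
        using p(1) partition_onD2[OF R] by (auto simp: disjnt_iff disjoint_def)
      with R R_split have "partition_on B (R - {p})" "p \<subseteq> insert a A"
        using partition_on_insert[of p "R - {p}" "insert a A"] by (auto simp: B_def)
      moreover have "B \<subseteq> A"
        using p(2) by (auto simp: B_def)
      moreover have "p = insert a (A - B)"
        using p(2) \<open>p \<subseteq> insert a A\<close> assms(2) by (auto simp: B_def)
      ultimately show "R \<in> ?f ` ?S"
        using R_split by (intro image_eqI[of _ _ "(B, R - {p})"]) auto
    qed
  qed
  then have "card {P. partition_on (insert a A) P} = card ?S"
    by (simp add: bij_betw_same_card)
  also have "\<dots> = (\<Sum>B\<in>Pow A. card {P. partition_on B P})"
    using assms(1) by (intro card_SigmaI) (auto intro: finitely_many_partition_on finite_subset)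
  finally show ?thesis .
qed

section \<open>Dobinski's formula\<close>

definition dobinski :: "nat \<Rightarrow> real" where
  "dobinski n = (\<Sum>k. real k ^ n / fact k)"

text \<open>
  The power \<open>k ^ n\<close> is at most \<open>n! * exp k\<close>, which leaves the exponential series at \<open>exp 1\<close>.
\<close>

lemma summable_dobinski: "summable (\<lambda>k. real k ^ n / fact k)"
proof (rule summable_comparison_test')
  show "summable (\<lambda>k. fact n * (inverse (fact k) * exp 1 ^ k :: real))"
    by (intro summable_mult summable_exp)
  fix k :: nat
  have "(\<lambda>m. real k ^ m /\<^sub>R fact m) sums exp (real k)"
    by (rule exp_converges)
  then have "(\<Sum>m\<in>{n}. real k ^ m /\<^sub>R fact m) \<le> exp (real k)"
    by (intro sum_le_suminf[THEN order_trans])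
      (auto simp: sums_iff)
  then have "real k ^ n \<le> fact n * exp 1 ^ k"
    by (simp add: field_simps exp_of_nat_mult[of k 1, simplified])
  then show "norm (real k ^ n / fact k) \<le> fact n * (inverse (fact k) * exp 1 ^ k)"
    by (simp add: field_simps)
qed

lemma dobinski_0: "dobinski 0 = exp 1"
  using exp_converges[of "1 :: real"] by (simp add: dobinski_def sums_iff divide_inverse)

text \<open>
  The factor \<open>k\<close> in \<open>k ^ (n + 1) / k!\<close> cancels against the factorial, so after an index shift the
  series is \<open>(\<Sum>k. (k + 1) ^ n / k!)\<close>.  The binomial expansion is indexed by subsets of \<open>A\<close>
  to match the recurrence for partitions.
\<close>

lemma dobinski_recurrence:
  assumes "finite A"
  shows "dobinski (Suc (card A)) = (\<Sum>B\<in>Pow A. dobinski (card B))"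
proof -
  have expand: "(real k + 1) ^ card A = (\<Sum>B\<in>Pow A. real k ^ card B)" for k
    using prod_add[OF assms, of "\<lambda>_. real k" "\<lambda>_. 1"] by simp
  have "dobinski (Suc (card A)) = (\<Sum>k. real (Suc k) ^ Suc (card A) / fact (Suc k))"
    using suminf_split_head[OF summable_dobinski, of "Suc (card A)"] by (simp add: dobinski_def)
  also have "\<dots> = (\<Sum>k. (real k + 1) ^ card A / fact k)"
  proof (rule suminf_cong)
    fix k :: nat
    have "real (Suc k) * real (Suc k) ^ card A / (real (Suc k) * fact k)
        = real (Suc k) ^ card A / fact k"
      by (rule mult_divide_mult_cancel_left) simp
    then show "real (Suc k) ^ Suc (card A) / fact (Suc k) = (real k + 1) ^ card A / fact k"
      by (simp add: add.commute)
  qed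
  also have "\<dots> = (\<Sum>k. \<Sum>B\<in>Pow A. real k ^ card B / fact k)"
    by (simp add: expand sum_divide_distrib)
  also have "\<dots> = (\<Sum>B\<in>Pow A. dobinski (card B))"
    unfolding dobinski_def by (intro suminf_sum summable_dobinski)
  finally show ?thesis .
qed

theorem dobinski_formula:
  assumes "finite A"
  shows "exp 1 * real (card {P. partition_on A P}) = dobinski (card A)"
  using assms
proof (induction A rule: finite_psubset_induct)
  case (psubset A)
  show ?case
  proof (cases "A = {}")
    case True
    then show ?thesis
      by (simp add: partition_on_empty dobinski_0)
  next
    case False
    then obtain a A' where A: "A = insert a A'" "a \<notin> A'"
      by (meson Set.set_insert ex_in_conv)
    then have fin: "finite A'"
      using psubset.hyps by simp
    have "exp 1 * real (card {P. partition_on A P})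
        = (\<Sum>B\<in>Pow A'. exp 1 * real (card {P. partition_on B P}))"
      using card_partitions_insert[OF fin A(2)] A(1) by (simp add: sum_distrib_left)
    also have "\<dots> = (\<Sum>B\<in>Pow A'. dobinski (card B))"
      using A by (intro sum.cong refl psubset.IH) auto
    also have "\<dots> = dobinski (card A)"
      using dobinski_recurrence[OF fin] A fin by simp
    finally show ?thesis .
  qed
qed

corollary dobinski_Bell: "dobinski n = exp 1 * real (Bell n)"
  using dobinski_formula[of "{1..n}"] by (simp add: Bell_def)

section \<open>Log-convexity\<close>

text \<open>
  This is the Cauchy--Schwarz inequality for the measure with mass \<open>k ^ n / k!\<close> at \<open>k\<close>, applied to
  the functions \<open>1\<close> and \<open>k\<close>.
\<close>

lemma dobinski_log_convex: "dobinski (Suc n) ^ 2 \<le> dobinski n * dobinski (Suc (Suc n))"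
proof -
  have pos: "0 < dobinski n"
    unfolding dobinski_def
    by (rule suminf_pos2[OF summable_dobinski, of _ 1]) auto
  have nonneg: "0 \<le> dobinski (Suc (Suc n)) - 2 * t * dobinski (Suc n) + t\<^sup>2 * dobinski n" for t
  proof -
    have "(\<lambda>k. real k ^ Suc (Suc n) / fact k - 2 * t * (real k ^ Suc n / fact k)
          + t\<^sup>2 * (real k ^ n / fact k))
        sums (dobinski (Suc (Suc n)) - 2 * t * dobinski (Suc n) + t\<^sup>2 * dobinski n)"
      unfolding dobinski_def
      by (intro sums_add sums_diff sums_mult summable_sums summable_dobinski)
    moreover have "real k ^ Suc (Suc n) / fact k - 2 * t * (real k ^ Suc n / fact k)
          + t\<^sup>2 * (real k ^ n / fact k) = real k ^ n * (real k - t)\<^sup>2 / fact k" for k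
      by (simp add: field_simps power2_eq_square)
    ultimately have "(\<lambda>k. real k ^ n * (real k - t)\<^sup>2 / fact k)
        sums (dobinski (Suc (Suc n)) - 2 * t * dobinski (Suc n) + t\<^sup>2 * dobinski n)"
      by simp
    then show ?thesis
      by (rule sums_le[OF _ sums_zero, rotated]) simp
  qed
  \<comment> \<open>The quadratic in \<open>t\<close> is smallest at this value.\<close>
  show ?thesis
    using nonneg[of "dobinski (Suc n) / dobinski n"] pos
    by (simp add: field_simps power2_eq_square)
qed

lemma Bell_log_convex: "real (Bell (Suc n)) ^ 2 \<le> real (Bell n) * real (Bell (Suc (Suc n)))"
  using dobinski_log_convex[of n]
  by (simp add: dobinski_Bell power2_eq_square)

lemma Bell_pos: "0 < Bell n"
proof -
  have "partition_on {1..n} ((\<lambda>x. {x}) ` {1..n})"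
    by (rule partition_on_singletons)
  then show ?thesis
    unfolding Bell_def by (auto simp: card_gt_0_iff finitely_many_partition_on)
qed

lemma Bell_0: "Bell 0 = 1"
  by (simp add: Bell_def partition_on_empty)

lemma Bell_1: "Bell 1 = 1"
  using card_partitions_insert[of "{}" "1 :: nat"] by (simp add: Bell_def partition_on_empty)

lemma Bell_2: "Bell 2 = 2"
proof -
  have "{1..2} = insert 2 {1 :: nat}"
    by auto
  then have "Bell 2 = (\<Sum>B\<in>Pow {1 :: nat}. card {P. partition_on B P})"
    unfolding Bell_def using card_partitions_insert[of "{1}" "2 :: nat"] by simp
  also have "\<dots> = Bell 0 + Bell 1"
    by (simp add: Bell_def Pow_insert)
  also have "\<dots> = 2"
    using Bell_1 by (simp add: Bell_0)
  finally show ?thesis .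
qed

section \<open>Roots of a log-convex sequence\<close>

text \<open>
  Raise \<open>b\<^sub>n\<^sub>+\<^sub>1\<^sup>2 \<le> b\<^sub>n * b\<^sub>n\<^sub>+\<^sub>2\<close> to the power \<open>n + 1\<close>, bound the power of \<open>b\<^sub>n\<close> by the
  induction hypothesis, and cancel \<open>b\<^sub>n\<^sub>+\<^sub>1 ^ n\<close>.
\<close>

lemma log_convex_power_less:
  fixes b :: "nat \<Rightarrow> real"
  assumes pos: "\<And>n. 0 < b n"
    and log_convex: "\<And>n. b (Suc n) ^ 2 \<le> b n * b (Suc (Suc n))"
    and base: "b 1 ^ 2 < b 2"
    and "1 \<le> n"
  shows "b n ^ Suc n < b (Suc n) ^ n"
  using \<open>1 \<le> n\<close>
proof (induction n rule: dec_induct)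
  case base
  show ?case
    using assms(3) by (simp add: numeral_2_eq_2)
next
  case (step n)
  have "b (Suc n) ^ n * b (Suc n) ^ Suc (Suc n) = (b (Suc n) ^ 2) ^ Suc n"
    by (simp flip: power_add power_mult add: mult_2)
  also have "\<dots> \<le> (b n * b (Suc (Suc n))) ^ Suc n"
    by (rule power_mono[OF log_convex]) simp
  also have "\<dots> = b n ^ Suc n * b (Suc (Suc n)) ^ Suc n"
    by (rule power_mult_distrib)
  also have "\<dots> < b (Suc n) ^ n * b (Suc (Suc n)) ^ Suc n"
    by (rule mult_strict_right_mono[OF step.IH]) (simp add: pos)
  finally show ?case
    using pos by (simp only: mult_less_cancel_left_pos zero_less_power)
qed

lemma root_less_root_Suc:
  fixes x y :: real
  assumes "1 \<le> n" "0 < x" "0 < y" "x ^ Suc n < y ^ n"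
  shows "root n x < root (Suc n) y"
proof -
  have "root n x = root (n * Suc n) (x ^ Suc n)"
    using assms by (simp only: real_root_mult_exp real_root_power_cancel zero_less_Suc less_imp_le)
  also have "\<dots> < root (n * Suc n) (y ^ n)"
    using assms by (intro real_root_less_mono) auto
  also have "\<dots> = root (Suc n * n) (y ^ n)"
    by (simp only: mult.commute)
  also have "\<dots> = root (Suc n) y"
    using assms by (simp only: real_root_mult_exp) (simp add: real_root_power_cancel)
  finally show ?thesis .
qed

theorem corollary5p3:
  shows "strict_mono_on {1..} (\<lambda>n::nat. root n (real (Bell n))) \<and>
    (\<forall>n::nat. n \<ge> 1 \<longrightarrow> root n (real (Bell n)) < root (n + 1) (real (Bell (n + 1))))"
proof -
  have step: "root n (real (Bell n)) < root (Suc n) (real (Bell (Suc n)))" if "1 \<le> n" for n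
  proof (rule root_less_root_Suc[OF that])
    have "real (Bell 1) ^ 2 < real (Bell 2)"
      by (simp only: Bell_1 Bell_2) simp
    with that show "real (Bell n) ^ Suc n < real (Bell (Suc n)) ^ n"
      by (intro log_convex_power_less[where b = "\<lambda>n. real (Bell n)"] Bell_log_convex)
        (simp_all only: Bell_pos of_nat_0_less_iff)
  qed (simp_all add: Bell_pos)
  have "strict_mono_on {1..} (\<lambda>n::nat. root n (real (Bell n)))"
  proof (rule strict_mono_onI)
    fix r s :: nat
    assume rs: "r \<in> {1..}" "s \<in> {1..}" "r < s"
    show "root r (real (Bell r)) < root s (real (Bell s))"
    proof (rule lift_Suc_mono_less_ivl[where f = "\<lambda>n. root n (real (Bell n))", OF _ \<open>r < s\<close>])
      show "{r..<s} \<subseteq> {1..}"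
        using rs by auto
    qed (simp add: step)
  qed
  moreover have "\<forall>n\<ge>1. root n (real (Bell n)) < root (n + 1) (real (Bell (n + 1)))"
    using step by simp
  ultimately show ?thesis ..
qed

end
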